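(* Let $d\ge3$. The $SL(2,\mathbb{R})$-orbits of totally positive $d$-tuples of real spinors are naturally bijective with $\widetilde T(d)$: the map sending a totally positive $d$-tuple $(\kappa_1,\ldots,\kappa_d)$ to the decorated ideal $d$-gon formed by the horocycles of $\kappa_1,\ldots,\kappa_d$ (with ideal vertices their centres) induces a bijection $$\frac{\{\text{Totally positive } d\text{-tuples of real spinors}\}}{SL(2,\mathbb{R})}\ \xrightarrow{\ \cong\ }\ \frac{\{\text{Decorated ideal } d\text{-gons}\}}{PSL(2,\mathbb{R})}=\widetilde T(d).$$
   Context: A real spinor is an element $\kappa=(\xi,\eta)\in\mathbb{R}^2$. For $\kappa=(\xi,\eta)$, $\kappa'=(\xi',\eta')$ put $\{\kappa,\kappa'\}=\xi\eta'-\eta\xi'$. A tuple $(\kappa_1,\ldots,\kappa_d)$ of spinors is totally positive if all $\kappa_i$ are real and $\{\kappa_i,\kappa_j\}>0$ for all $i<j$. $SL(2,\mathbb{R})$ acts on $d$-tuples by $A.(\kappa_1,\ldots,\kappa_d)=(A\kappa_1,\ldots,A\kappa_d)$. In the upper half plane model $\mathbb{U}^2$ of the hyperbolic plane, with boundary $\mathbb{R}\cup\{\infty\}$, the horocycle of a nonzero real spinor $(\xi,\eta)$ has centre (point at infinity) $\xi/\eta$; if $\eta\neq0$ it is the circle tangent to $\mathbb{R}$ of Euclidean diameter $\eta^{-2}$, and if $\eta=0$ it is the horizontal line at height $\xi^2$. (This is the intersection with $\mathbb{U}^2\subset\mathbb{U}^3$ of the spin-decorated horosphere corresponding to the spinor,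 with its planar spin decoration forgotten.) The boundary circle $\partial\mathbb{U}^2$ is oriented in the negative real direction. An ideal $d$-gon is a collection of distinct points $z_1,\ldots,z_d\in\partial\mathbb{U}^2$ labelled in order around the oriented boundary, i.e. for some $k$ either all are real and $z_k>z_{k+1}>\cdots>z_d>z_1>\cdots>z_{k-1}$, or $z_k=\infty$ and $z_{k+1}>\cdots>z_d>z_1>\cdots>z_{k-1}$. A decoration on an ideal $d$-gon is a choice of horocycle centred at each $z_i$. $\widetilde T(d)$ is the space of decorated ideal $d$-gons up to orientation-preserving isometries of $\mathbb{U}^2$, i.e. up to the action of $PSL(2,\mathbb{R})$ by Möbius transformations. *)

theory Defs
  imports "HOL-Analysis.Analysis" "HOL-Algebra.Group_Action"
begin

section \<open>Real spinors\<close>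

text \<open>A real spinor \<open>(\<xi>, \<eta>)\<close> is a vector \<open>\<kappa>\<close> with \<open>\<xi> = \<kappa> $ 1\<close> and \<open>\<eta> = \<kappa> $ 2\<close>;
  an \<open>n\<close>-tuple is a list of length \<open>n\<close>, so \<open>\<kappa>\<^sub>i\<close> of the usual notation is \<open>ks ! (i - 1)\<close>.\<close>

type_synonym spinor = "real ^ 2"

definition bracket :: "spinor \<Rightarrow> spinor \<Rightarrow> real" where
  "bracket \<kappa> \<kappa>' = \<kappa> $ 1 * \<kappa>' $ 2 - \<kappa> $ 2 * \<kappa>' $ 1"

definition totally_positive :: "nat \<Rightarrow> spinor list set" where
  "totally_positive d =
     {ks. length ks = d \<and> (\<forall>i j. i < j \<and> j < d \<longrightarrow> bracket (ks ! i) (ks ! j) > 0)}"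

definition SL2R :: "(real ^ 2 ^ 2) monoid" where
  "SL2R = \<lparr>carrier = {A. det A = 1}, mult = (**), one = mat 1\<rparr>"

definition spinor_act :: "real ^ 2 ^ 2 \<Rightarrow> spinor list \<Rightarrow> spinor list" where
  "spinor_act A ks = map (\<lambda>\<kappa>. A *v \<kappa>) ks"

section \<open>The upper half plane, its boundary, and horocycles\<close>

definition upper_half_plane :: "complex set" where
  "upper_half_plane = {w. Im w > 0}"

datatype ideal_point = Fin real | Infty

text \<open>Horocycles are sets of points of the upper half plane; in particular the point of tangency
  of a Euclidean circle with the real line is not included.\<close>

definition circle_horocycle :: "real \<Rightarrow> real \<Rightarrow> complex set" where
  "circle_horocycle x D = sphere (Complex x (D / 2)) (D / 2) \<inter> upper_half_plane"

definition line_horocycle :: "real \<Rightarrow> complex set" where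
  "line_horocycle h = {w \<in> upper_half_plane. Im w = h}"

fun horocycles_at :: "ideal_point \<Rightarrow> complex set set" where
  "horocycles_at (Fin x) = {circle_horocycle x D |D. D > 0}"
| "horocycles_at Infty = {line_horocycle h |h. h > 0}"

text \<open>Centre and horocycle of a spinor; only meaningful for nonzero spinors. The members of a
  totally positive tuple with at least two entries are nonzero.\<close>

definition spinor_centre :: "spinor \<Rightarrow> ideal_point" where
  "spinor_centre \<kappa> = (if \<kappa> $ 2 = 0 then Infty else Fin (\<kappa> $ 1 / \<kappa> $ 2))"

definition spinor_horocycle :: "spinor \<Rightarrow> complex set" where
  "spinor_horocycle \<kappa> =
     (if \<kappa> $ 2 = 0 then line_horocycle ((\<kappa> $ 1)\<^sup>2)
      else circle_horocycle (\<kappa> $ 1 / \<kappa> $ 2) (1 / (\<kappa> $ 2)\<^sup>2))"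

section \<open>Decorated ideal polygons\<close>

text \<open>The boundary is oriented in the negative real direction. With vertices
  \<open>z\<^sub>1, \<dots>, z\<^sub>d\<close> stored in \<open>zs\<close>, the list \<open>rotate k zs\<close> is
  \<open>z\<^sub>k\<^sub>+\<^sub>1, \<dots>, z\<^sub>d, z\<^sub>1, \<dots>, z\<^sub>k\<close>.\<close>

definition ideal_polygons :: "nat \<Rightarrow> ideal_point list set" where
  "ideal_polygons d =
     {zs. length zs = d \<and> distinct zs \<and>
          (\<exists>k<d. \<exists>xs. sorted_wrt (>) xs \<and>
             (rotate k zs = map Fin xs \<or> rotate k zs = Infty # map Fin xs))}"

type_synonym decorated_polygon = "(ideal_point \<times> complex set) list"

definition decorated_ideal_polygons :: "nat \<Rightarrow> decorated_polygon set" where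
  "decorated_ideal_polygons d =
     {P. map fst P \<in> ideal_polygons d \<and> (\<forall>(z, H) \<in> set P. H \<in> horocycles_at z)}"

definition polygon_of_spinors :: "spinor list \<Rightarrow> decorated_polygon" where
  "polygon_of_spinors ks = map (\<lambda>\<kappa>. (spinor_centre \<kappa>, spinor_horocycle \<kappa>)) ks"

section \<open>Moebius transformations\<close>

definition moebius :: "real ^ 2 ^ 2 \<Rightarrow> complex \<Rightarrow> complex" where
  "moebius A w = (of_real (A $ 1 $ 1) * w + of_real (A $ 1 $ 2)) /
                 (of_real (A $ 2 $ 1) * w + of_real (A $ 2 $ 2))"

fun moebius_boundary :: "real ^ 2 ^ 2 \<Rightarrow> ideal_point \<Rightarrow> ideal_point" where
  "moebius_boundary A (Fin x) =
     (if A $ 2 $ 1 * x + A $ 2 $ 2 = 0 then Infty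
      else Fin ((A $ 1 $ 1 * x + A $ 1 $ 2) / (A $ 2 $ 1 * x + A $ 2 $ 2)))"
| "moebius_boundary A Infty =
     (if A $ 2 $ 1 = 0 then Infty else Fin (A $ 1 $ 1 / A $ 2 $ 1))"

definition moebius_polygon :: "real ^ 2 ^ 2 \<Rightarrow> decorated_polygon \<Rightarrow> decorated_polygon" where
  "moebius_polygon A P = map (\<lambda>(z, H). (moebius_boundary A z, moebius A ` H)) P"

definition PSL2R :: "(real ^ 2 ^ 2) set monoid" where
  "PSL2R = SL2R Mod {mat 1, - mat 1}"

text \<open>A class \<open>{A, - A}\<close> acts through either representative; see \<open>polygon_act_class\<close>.\<close>

definition polygon_act :: "(real ^ 2 ^ 2) set \<Rightarrow> decorated_polygon \<Rightarrow> decorated_polygon" where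
  "polygon_act C P = the_elem ((\<lambda>A. moebius_polygon A P) ` C)"

definition T_tilde :: "nat \<Rightarrow> decorated_polygon set set" where
  "T_tilde d = orbits PSL2R (decorated_ideal_polygons d) polygon_act"

section \<open>Well-definedness of the groups and of the quotient action\<close>

lemma det_uminus_2: "det (- A) = det (A :: real ^ 2 ^ 2)"
  by (simp add: det_2)

lemma group_SL2R: "group SL2R"
proof (rule groupI)
  fix A assume "A \<in> carrier SL2R"
  then have d: "det A = 1"
    by (simp add: SL2R_def)
  then have "invertible A"
    by (simp add: invertible_det_nz)
  then obtain B where 1: "B ** A = mat 1"
    by (auto simp: invertible_def)
  have "det B * det A = 1"
    by (simp add: 1 det_I flip: det_mul)
  with d have "det B = 1" by simp
  with 1 show "\<exists>B\<in>carrier SL2R. B \<otimes>\<^bsub>SL2R\<^esub> A = \<one>\<^bsub>SL2R\<^esub>"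
    by (auto simp: SL2R_def)
qed (auto simp: SL2R_def det_mul det_I matrix_mul_assoc)

lemma uminus_mat_1_mult:
  fixes A :: "real ^ 2 ^ 2"
  shows "(- mat 1) ** A = - A" "A ** (- mat 1) = - A"
  by (simp_all add: vec_eq_iff matrix_matrix_mult_def sum_2 mat_def forall_2)

lemma normal_center_SL2R: "{mat 1, - mat 1} \<lhd> SL2R"
proof -
  interpret group SL2R by (rule group_SL2R)
  have sub: "subgroup {mat 1, - mat 1} SL2R"
  proof (rule subgroupI)
    fix a assume a: "a \<in> {mat 1, - mat 1 :: real ^ 2 ^ 2}"
    have "inv\<^bsub>SL2R\<^esub> a = a"
      by (rule inv_equality) (use a in \<open>auto simp: SL2R_def uminus_mat_1_mult det_uminus_2 det_I\<close>)
    with a show "inv\<^bsub>SL2R\<^esub> a \<in> {mat 1, - mat 1}" by simp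
  qed (auto simp: SL2R_def uminus_mat_1_mult det_uminus_2 det_I)
  show ?thesis
    by (rule normalI[OF sub])
       (auto simp: r_coset_def l_coset_def SL2R_def uminus_mat_1_mult)
qed

lemma carrier_PSL2R: "carrier PSL2R = {{A, - A} |A. A \<in> carrier SL2R}"
  by (auto simp: PSL2R_def FactGroup_def RCOSETS_def r_coset_def SL2R_def uminus_mat_1_mult)

lemma moebius_polygon_uminus: "moebius_polygon (- A) P = moebius_polygon A P"
proof -
  have *: "moebius (- A) = moebius A"
  proof
    fix w
    have "moebius (- A) w =
        (- (of_real (A $ 1 $ 1) * w + of_real (A $ 1 $ 2))) /
        (- (of_real (A $ 2 $ 1) * w + of_real (A $ 2 $ 2)))"
      by (simp add: moebius_def)
    then show "moebius (- A) w = moebius A w"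
      by (simp only: minus_divide_divide moebius_def)
  qed
  have **: "moebius_boundary (- A) z = moebius_boundary A z" for z
  proof (cases z)
    case (Fin x)
    have e: "- (A $ 2 $ 1 * x) - A $ 2 $ 2 = - (A $ 2 $ 1 * x + A $ 2 $ 2)"
            "- (A $ 1 $ 1 * x) - A $ 1 $ 2 = - (A $ 1 $ 1 * x + A $ 1 $ 2)"
      by simp_all
    show ?thesis
      by (simp only: Fin moebius_boundary.simps vector_uminus_component mult_minus_left
            add_uminus_conv_diff e minus_divide_divide neg_equal_0_iff_equal)
  qed simp
  show ?thesis
    by (simp add: moebius_polygon_def * **)
qed

lemma polygon_act_class:
  assumes "C \<in> carrier PSL2R" "A \<in> C"
  shows "polygon_act C P = moebius_polygon A P"
proof -
  obtain B where "C = {B, - B}"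
    using assms by (auto simp: carrier_PSL2R)
  with assms have "(\<lambda>A. moebius_polygon A P) ` C = {moebius_polygon A P}"
    by (auto simp: moebius_polygon_uminus)
  then show ?thesis
    by (simp add: polygon_act_def)
qed

end

theory Submission
  imports Defs
begin

text \<open>
  The horocycle of a nonzero spinor \<open>\<kappa> = (\<xi>, \<eta>)\<close> is the set of all \<open>w\<close> in the upper half plane with
  \<open>\<bar>\<xi> - \<eta> w\<bar>\<^sup>2 = Im w\<close>. This description makes no distinction between circles and lines, and both sides
  of the equation pick up the factor \<open>\<bar>c w + d\<bar>\<^sup>-\<^sup>2\<close> under a matrix with lower row \<open>(c, d)\<close>. Hence the map
  from spinors to horocycles is equivariant. Its fibres are the pairs \<open>{\<kappa>, - \<kappa>}\<close>, so everything else
  is a question of signs.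

  Every decorated ideal point has exactly one lift in the half plane of spinors that point upward
  (\<open>upward\<close>), and for two upward spinors the bracket is positive exactly if the first centre precedes
  the second one on the boundary circle, oriented in the negative real direction and cut open before
  \<open>\<infinity>\<close> (\<open>bracket_pos_iff_clockwise\<close>). A list of upward spinors is therefore totally positive exactly
  if its centres run around this cut circle in order. General tuples are reduced to this case by a twisted
  cyclic symmetry: moving an initial segment of a totally positive tuple to the end and negating it
  gives a totally positive tuple again (\<open>tot_pos_rotate\<close>), and its decorated polygon is the rotated
  one. Each totally positive tuple can be rotated so that all its members point upward, or
  all downward (\<open>tot_pos_split\<close>); thus its polygon is ideal. Conversely, a decorated polygon is
  rotated to start at the cut, lifted upward, and rotated back.

  Finally, two totally positive tuples with the same polygon differ by a sign in each entry, and
  positivity of the brackets forces all these signs to agree. As \<open>- 1 \<in> SL(2, \<real>)\<close>, the tuples lie in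
  the same orbit. So a set of totally positive tuples that is an orbit can be recovered from its image
  in the set of decorated polygons, and the bijection is given by taking images.
\<close>

section \<open>Brackets and horocycles under matrices\<close>

abbreviation tot_pos :: "spinor list \<Rightarrow> bool" where
  "tot_pos \<equiv> sorted_wrt (\<lambda>\<kappa> \<kappa>'. bracket \<kappa> \<kappa>' > 0)"

lemma totally_positive_iff: "ks \<in> totally_positive d \<longleftrightarrow> length ks = d \<and> tot_pos ks"
  by (auto simp: totally_positive_def sorted_wrt_iff_nth_less)

lemma bracket_uminus [simp]:
  "bracket (- \<kappa>) \<kappa>' = - bracket \<kappa> \<kappa>'" "bracket \<kappa> (- \<kappa>') = - bracket \<kappa> \<kappa>'"
  by (simp_all add: bracket_def)

lemma matrix_vector_mult_2:
  fixes A :: "real ^ 2 ^ 2"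
  shows "(A *v \<kappa>) $ 1 = A $ 1 $ 1 * \<kappa> $ 1 + A $ 1 $ 2 * \<kappa> $ 2"
    and "(A *v \<kappa>) $ 2 = A $ 2 $ 1 * \<kappa> $ 1 + A $ 2 $ 2 * \<kappa> $ 2"
  by (simp_all add: matrix_vector_mult_def sum_2)

lemma bracket_matrix: "bracket (A *v \<kappa>) (A *v \<kappa>') = det A * bracket \<kappa> \<kappa>'"
  by (simp add: bracket_def matrix_vector_mult_2 det_2 algebra_simps)

lemma vec2_eq_iff: "\<kappa> = \<kappa>' \<longleftrightarrow> \<kappa> $ 1 = \<kappa>' $ 1 \<and> \<kappa> $ 2 = \<kappa>' $ 2" for \<kappa> \<kappa>' :: "'a ^ 2"
  by (simp add: vec_eq_iff forall_2)

lemma tot_pos_nonzero: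
  assumes "tot_pos ks" "length ks \<ge> 2" "\<kappa> \<in> set ks"
  shows "\<kappa> \<noteq> 0"
proof
  assume "\<kappa> = 0"
  then have zero: "bracket \<kappa> \<kappa>' = 0" "bracket \<kappa>' \<kappa> = 0" for \<kappa>'
    by (simp_all add: bracket_def)
  obtain i where i: "i < length ks" "ks ! i = \<kappa>"
    using assms(3) by (auto simp: in_set_conv_nth)
  obtain j where "j < length ks" "j \<noteq> i"
    using assms(2) that[of 0] that[of 1] by fastforce
  with i assms(1) have "bracket \<kappa> (ks ! j) > 0 \<or> bracket (ks ! j) \<kappa> > 0"
    by (metis linorder_neqE_nat sorted_wrt_iff_nth_less)
  with zero show False by simp
qed

lemma cmod_square_diff_real:
  "(cmod (of_real x - of_real y * w))\<^sup>2 = (x - y * Re w)\<^sup>2 + (y * Im w)\<^sup>2"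
  by (simp add: cmod_power2)

text \<open>One equation for both kinds of horocycles: divided by \<open>\<eta>\<^sup>2\<close>, it is the circle
  \<open>\<bar>w - x\<bar>\<^sup>2 = D Im w\<close> of diameter \<open>D = \<eta>\<^sup>-\<^sup>2\<close> tangent to the real line at \<open>x = \<xi> / \<eta>\<close>.\<close>

lemma spinor_horocycle_eq:
  "spinor_horocycle \<kappa> = {w. Im w > 0 \<and> (cmod (of_real (\<kappa> $ 1) - of_real (\<kappa> $ 2) * w))\<^sup>2 = Im w}"
proof (cases "\<kappa> $ 2 = 0")
  case True
  then show ?thesis
    by (auto simp: spinor_horocycle_def line_horocycle_def upper_half_plane_def)
next
  case False
  define D x where "D = 1 / (\<kappa> $ 2)\<^sup>2" and "x = \<kappa> $ 1 / \<kappa> $ 2"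
  have D: "D > 0" and xi: "\<kappa> $ 1 = x * \<kappa> $ 2" and eta: "D * (\<kappa> $ 2)\<^sup>2 = 1"
    using False by (simp_all add: D_def x_def)
  have "w \<in> sphere (Complex x (D / 2)) (D / 2) \<longleftrightarrow>
      (cmod (of_real (\<kappa> $ 1) - of_real (\<kappa> $ 2) * w))\<^sup>2 = Im w" for w
  proof -
    have "w \<in> sphere (Complex x (D / 2)) (D / 2) \<longleftrightarrow>
        (cmod (Complex x (D / 2) - w))\<^sup>2 = (D / 2)\<^sup>2"
      using D by (simp add: dist_norm power2_eq_iff_nonneg)
    also have "\<dots> \<longleftrightarrow> (x - Re w)\<^sup>2 + (Im w)\<^sup>2 = D * Im w"
      by (auto simp: cmod_power2 power2_diff algebra_simps)
    also have "\<dots> \<longleftrightarrow> (\<kappa> $ 2)\<^sup>2 * ((x - Re w)\<^sup>2 + (Im w)\<^sup>2) = (\<kappa> $ 2)\<^sup>2 * (D * Im w)"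
      using False by simp
    also have "\<dots> \<longleftrightarrow> (cmod (of_real (\<kappa> $ 1) - of_real (\<kappa> $ 2) * w))\<^sup>2 = Im w"
    proof -
      have "(\<kappa> $ 2)\<^sup>2 * (D * Im w) = (D * (\<kappa> $ 2)\<^sup>2) * Im w"
        by simp
      moreover have "(\<kappa> $ 2)\<^sup>2 * ((x - Re w)\<^sup>2 + (Im w)\<^sup>2) =
          (\<kappa> $ 1 - \<kappa> $ 2 * Re w)\<^sup>2 + (\<kappa> $ 2 * Im w)\<^sup>2"
        by (simp add: xi power2_eq_square algebra_simps)
      ultimately show ?thesis
        by (simp only: cmod_square_diff_real eta) simp
    qed
    finally show ?thesis .
  qed
  then have "circle_horocycle x D =
      {w. Im w > 0 \<and> (cmod (of_real (\<kappa> $ 1) - of_real (\<kappa> $ 2) * w))\<^sup>2 = Im w}"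
    unfolding circle_horocycle_def upper_half_plane_def by blast
  with False show ?thesis
    by (simp add: spinor_horocycle_def D_def x_def)
qed

lemma moebius_denominator_nonzero:
  fixes A :: "real ^ 2 ^ 2"
  assumes "det A = 1" "Im w > 0"
  shows "of_real (A $ 2 $ 1) * w + of_real (A $ 2 $ 2) \<noteq> 0"
proof
  assume 0: "of_real (A $ 2 $ 1) * w + of_real (A $ 2 $ 2) = 0"
  then have "A $ 2 $ 1 * Im w = 0" "A $ 2 $ 1 * Re w + A $ 2 $ 2 = 0"
    by (auto simp: complex_eq_iff)
  with assms show False by (simp add: det_2)
qed

lemma Im_moebius:
  assumes "det A = 1" "Im w > 0"
  shows "Im (moebius A w) = Im w / (cmod (of_real (A $ 2 $ 1) * w + of_real (A $ 2 $ 2)))\<^sup>2"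
proof -
  have "Im (moebius A w) = (det A * Im w) / (cmod (of_real (A $ 2 $ 1) * w + of_real (A $ 2 $ 2)))\<^sup>2"
    by (simp add: moebius_def Im_divide cmod_power2 det_2 algebra_simps)
  with assms show ?thesis by simp
qed

text \<open>With \<open>q = c w + d\<close>, the equation of \<open>spinor_horocycle_eq\<close> is divided by \<open>\<bar>q\<bar>\<^sup>2\<close>: on the right because
  \<open>Im (A w) = Im w / \<bar>q\<bar>\<^sup>2\<close>, and on the left because \<open>\<xi> - \<eta> w\<close> is the bracket of \<open>\<kappa>\<close> with the complex
  vector \<open>(w, 1)\<close>, which \<open>A\<close> maps to \<open>q\<close> times \<open>(A w, 1)\<close>.\<close>

lemma moebius_horocycle_subset:
  assumes A: "det A = 1"
  shows "moebius A ` spinor_horocycle \<kappa> \<subseteq> spinor_horocycle (A *v \<kappa>)"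
proof
  fix v assume "v \<in> moebius A ` spinor_horocycle \<kappa>"
  then obtain w where v: "v = moebius A w" and w: "Im w > 0"
    and eq: "(cmod (of_real (\<kappa> $ 1) - of_real (\<kappa> $ 2) * w))\<^sup>2 = Im w"
    by (auto simp: spinor_horocycle_eq)
  let ?q = "of_real (A $ 2 $ 1) * w + of_real (A $ 2 $ 2) :: complex"
  let ?p = "of_real (A $ 1 $ 1) * w + of_real (A $ 1 $ 2) :: complex"
  have q: "?q \<noteq> 0"
    by (rule moebius_denominator_nonzero[OF A w])
  have "of_real ((A *v \<kappa>) $ 1) - of_real ((A *v \<kappa>) $ 2) * v
      = (of_real ((A *v \<kappa>) $ 1) * ?q - of_real ((A *v \<kappa>) $ 2) * ?p) / ?q"
    using q by (simp add: v moebius_def diff_divide_distrib)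
  also have "of_real ((A *v \<kappa>) $ 1) * ?q - of_real ((A *v \<kappa>) $ 2) * ?p
      = of_real (det A) * (of_real (\<kappa> $ 1) - of_real (\<kappa> $ 2) * w)"
    by (simp add: matrix_vector_mult_2 det_2 algebra_simps)
  finally have "of_real ((A *v \<kappa>) $ 1) - of_real ((A *v \<kappa>) $ 2) * v
      = (of_real (\<kappa> $ 1) - of_real (\<kappa> $ 2) * w) / ?q"
    by (simp add: A)
  then have "(cmod (of_real ((A *v \<kappa>) $ 1) - of_real ((A *v \<kappa>) $ 2) * v))\<^sup>2 = Im v"
    by (simp add: norm_divide power_divide eq Im_moebius[OF A w] v)
  moreover have "Im v > 0"
    using w q by (simp add: v Im_moebius[OF A w])
  ultimately show "v \<in> spinor_horocycle (A *v \<kappa>)"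
    by (simp add: spinor_horocycle_eq)
qed

lemma moebius_mult:
  assumes "det B = 1" "Im w > 0"
  shows "moebius A (moebius B w) = moebius (A ** B) w"
proof -
  let ?q = "of_real (B $ 2 $ 1) * w + of_real (B $ 2 $ 2) :: complex"
  let ?p = "of_real (B $ 1 $ 1) * w + of_real (B $ 1 $ 2) :: complex"
  have q: "?q \<noteq> 0"
    by (rule moebius_denominator_nonzero[OF assms])
  have "moebius A (moebius B w) =
      ((of_real (A $ 1 $ 1) * (?p / ?q) + of_real (A $ 1 $ 2)) * ?q) /
      ((of_real (A $ 2 $ 1) * (?p / ?q) + of_real (A $ 2 $ 2)) * ?q)"
    by (simp add: moebius_def mult_divide_mult_cancel_right[OF q] del: distrib_right)
  also have "\<dots> = (of_real (A $ 1 $ 1) * ?p + of_real (A $ 1 $ 2) * ?q) /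
      (of_real (A $ 2 $ 1) * ?p + of_real (A $ 2 $ 2) * ?q)"
    using q by (simp add: distrib_right)
  also have "\<dots> = moebius (A ** B) w"
    by (simp add: moebius_def matrix_matrix_mult_def sum_2 algebra_simps)
  finally show ?thesis .
qed

lemma moebius_horocycle:
  assumes A: "det A = 1"
  shows "moebius A ` spinor_horocycle \<kappa> = spinor_horocycle (A *v \<kappa>)"
proof
  show "spinor_horocycle (A *v \<kappa>) \<subseteq> moebius A ` spinor_horocycle \<kappa>"
  proof
    fix v assume v: "v \<in> spinor_horocycle (A *v \<kappa>)"
    obtain B where AB: "A ** B = mat 1" "B ** A = mat 1"
      using A by (metis invertible_def invertible_det_nz zero_neq_one)
    have "det A * det B = 1"
      by (simp add: AB flip: det_mul)
    with A have B: "det B = 1" by simp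
    have "moebius B v \<in> spinor_horocycle (B *v (A *v \<kappa>))"
      using moebius_horocycle_subset[OF B] v by blast
    then have "moebius B v \<in> spinor_horocycle \<kappa>"
      by (simp add: matrix_vector_mul_assoc AB)
    moreover have "moebius A (moebius B v) = v"
      using v by (simp add: moebius_mult B AB spinor_horocycle_eq)
        (simp add: moebius_def mat_def)
    ultimately show "v \<in> moebius A ` spinor_horocycle \<kappa>"
      by (metis image_eqI)
  qed
qed (rule moebius_horocycle_subset[OF A])

lemma moebius_centre:
  assumes A: "det A = 1" and "\<kappa> \<noteq> 0"
  shows "moebius_boundary A (spinor_centre \<kappa>) = spinor_centre (A *v \<kappa>)"
proof (cases "\<kappa> $ 2 = 0")
  case True
  with \<open>\<kappa> \<noteq> 0\<close> have "\<kappa> $ 1 \<noteq> 0"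
    by (simp add: vec2_eq_iff)
  with True show ?thesis
    by (simp add: spinor_centre_def matrix_vector_mult_2)
next
  case False
  have *: "A $ i $ 1 * (\<kappa> $ 1 / \<kappa> $ 2) + A $ i $ 2
      = (A $ i $ 1 * \<kappa> $ 1 + A $ i $ 2 * \<kappa> $ 2) / \<kappa> $ 2" for i
    using False by (simp add: field_simps)
  show ?thesis
    using False by (simp only: spinor_centre_def if_False moebius_boundary.simps *
        matrix_vector_mult_2 divide_eq_0_iff divide_divide_eq_left divide_divide_eq_right) simp
qed

text \<open>The centre determines the ratio of the coordinates, and the size of the horocycle determines
  the square of a nonzero coordinate.\<close>

lemma spinor_eq_up_to_sign:
  assumes "spinor_centre \<kappa> = spinor_centre \<kappa>'" "spinor_horocycle \<kappa> = spinor_horocycle \<kappa>'"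
    and "\<kappa> \<noteq> 0"
  shows "\<kappa>' = \<kappa> \<or> \<kappa>' = - \<kappa>"
proof (cases "\<kappa> $ 2 = 0")
  case True
  with assms(1) have 2: "\<kappa>' $ 2 = 0"
    by (auto simp: spinor_centre_def split: if_splits)
  have "Complex 0 ((\<kappa> $ 1)\<^sup>2) \<in> spinor_horocycle \<kappa>"
    using True assms(3) by (simp add: spinor_horocycle_eq vec2_eq_iff)
  with assms(2) 2 have "(\<kappa>' $ 1)\<^sup>2 = (\<kappa> $ 1)\<^sup>2"
    by (auto simp: spinor_horocycle_eq)
  with True 2 show ?thesis
    by (auto simp: vec2_eq_iff power2_eq_iff)
next
  case False
  define x where "x = \<kappa> $ 1 / \<kappa> $ 2"
  have 2: "\<kappa>' $ 2 \<noteq> 0" and x': "\<kappa>' $ 1 / \<kappa>' $ 2 = x"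
    using assms(1) False by (auto simp: spinor_centre_def x_def split: if_splits)
  then have x: "\<kappa> $ 1 = x * \<kappa> $ 2" "\<kappa>' $ 1 = x * \<kappa>' $ 2"
    using False by (auto simp: x_def field_simps)
  have above_centre: "(cmod (of_real (\<mu> $ 1) - of_real (\<mu> $ 2) * Complex x t))\<^sup>2 = (\<mu> $ 2)\<^sup>2 * t\<^sup>2"
    if "\<mu> $ 1 = x * \<mu> $ 2" for \<mu> :: spinor and t
    by (simp only: cmod_square_diff_real that) (simp add: power_mult_distrib)
  define D where "D = 1 / (\<kappa> $ 2)\<^sup>2"
  have D: "D > 0" "(\<kappa> $ 2)\<^sup>2 * D = 1"
    using False by (simp_all add: D_def)
  \<comment> \<open>The highest point of the horocycle of \<open>\<kappa>\<close> lies straight above the centre at height \<open>\<eta>\<^sup>-\<^sup>2\<close>.\<close>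
  have "Complex x D \<in> spinor_horocycle \<kappa>"
    using D by (simp add: spinor_horocycle_eq above_centre[OF x(1)] power2_eq_square[of D]
        flip: mult.assoc)
  then have "Complex x D \<in> spinor_horocycle \<kappa>'"
    by (simp add: assms(2))
  then have "(\<kappa>' $ 2)\<^sup>2 * D\<^sup>2 = D"
    by (simp add: spinor_horocycle_eq above_centre[OF x(2)])
  with D have "(\<kappa>' $ 2)\<^sup>2 * D = (\<kappa> $ 2)\<^sup>2 * D"
    by (simp add: power2_eq_square[of D] flip: mult.assoc)
  with D(1) have "(\<kappa>' $ 2)\<^sup>2 = (\<kappa> $ 2)\<^sup>2"
    by simp
  then show ?thesis
    using x by (auto simp: vec2_eq_iff power2_eq_iff)
qed

lemma spinor_centre_uminus [simp]: "spinor_centre (- \<kappa>) = spinor_centre \<kappa>"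
  by (simp add: spinor_centre_def)

lemma spinor_horocycle_uminus [simp]: "spinor_horocycle (- \<kappa>) = spinor_horocycle \<kappa>"
  by (simp add: spinor_horocycle_def)

lemma polygon_of_spinors_append [simp]:
  "polygon_of_spinors (xs @ ys) = polygon_of_spinors xs @ polygon_of_spinors ys"
  by (simp add: polygon_of_spinors_def)

lemma polygon_of_spinors_uminus [simp]:
  "polygon_of_spinors (map uminus ks) = polygon_of_spinors ks"
  by (simp add: polygon_of_spinors_def)

lemma polygon_of_spinors_act:
  assumes "det A = 1" "0 \<notin> set ks"
  shows "moebius_polygon A (polygon_of_spinors ks) = polygon_of_spinors (spinor_act A ks)"
  using assms
  by (auto simp: moebius_polygon_def polygon_of_spinors_def spinor_act_def moebius_horocycle
      intro!: moebius_centre)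

section \<open>Upward spinors and the cut boundary circle\<close>

text \<open>A half-open half plane, so that every nonzero spinor or its negative belongs to it, and not
  both. The boundary ray is chosen such that \<open>\<infinity>\<close> comes first on the cut circle.\<close>

definition upward :: "spinor \<Rightarrow> bool" where
  "upward \<kappa> \<longleftrightarrow> \<kappa> $ 2 > 0 \<or> \<kappa> $ 2 = 0 \<and> \<kappa> $ 1 > 0"

lemma upward_or_uminus: "\<kappa> \<noteq> 0 \<Longrightarrow> upward \<kappa> \<or> upward (- \<kappa>)"
  by (auto simp: upward_def vec2_eq_iff)

fun clockwise :: "ideal_point \<Rightarrow> ideal_point \<Rightarrow> bool" where
  "clockwise Infty (Fin y) = True"
| "clockwise (Fin x) (Fin y) = (x > y)"
| "clockwise z Infty = False"

text \<open>Away from \<open>\<infinity>\<close> the reason is \<open>{\<kappa>, \<kappa>'} = \<eta> \<eta>' (\<xi> / \<eta> - \<xi>' / \<eta>')\<close>.\<close>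

lemma bracket_pos_iff_clockwise:
  assumes "upward \<kappa>" "upward \<kappa>'"
  shows "bracket \<kappa> \<kappa>' > 0 \<longleftrightarrow> clockwise (spinor_centre \<kappa>) (spinor_centre \<kappa>')"
  using assms
  by (auto simp: upward_def bracket_def spinor_centre_def field_simps zero_less_mult_iff
      mult_less_0_iff)

lemma sorted_wrt_clockwise_iff:
  "sorted_wrt clockwise zs \<longleftrightarrow>
     (\<exists>xs. sorted_wrt (>) xs \<and> (zs = map Fin xs \<or> zs = Infty # map Fin xs))"
proof
  assume *: "sorted_wrt clockwise zs"
  show "\<exists>xs. sorted_wrt (>) xs \<and> (zs = map Fin xs \<or> zs = Infty # map Fin xs)"
  proof (cases zs)
    case (Cons z ws)
    have "\<exists>x. w = Fin x" if "w \<in> set ws" for w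
      using * that Cons by (cases w) auto
    then obtain xs where ws: "ws = map Fin xs"
      by (metis ex_map_conv)
    with * Cons have xs: "sorted_wrt (>) xs"
      by (simp add: sorted_wrt_map)
    show ?thesis
    proof (cases z)
      case (Fin x)
      with * Cons ws have "sorted_wrt (>) (x # xs)"
        by (simp add: sorted_wrt_map)
      with Fin Cons ws show ?thesis
        by (metis list.simps(9))
    qed (use Cons ws xs in blast)
  qed (auto intro!: exI[of _ "[]"])
qed (auto simp: sorted_wrt_map)

lemma sorted_wrt_clockwise_distinct: "sorted_wrt clockwise zs \<Longrightarrow> distinct zs"
proof (induction zs)
  case (Cons z zs)
  then show ?case by (cases z) auto
qed simp

lemma ideal_polygons_iff:
  "zs \<in> ideal_polygons d \<longleftrightarrow>
     length zs = d \<and> (\<exists>k<d. sorted_wrt clockwise (rotate k zs))"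
  unfolding ideal_polygons_def mem_Collect_eq sorted_wrt_clockwise_iff[symmetric]
  using sorted_wrt_clockwise_distinct distinct_rotate by blast

lemma tot_pos_iff_sorted_wrt_clockwise:
  assumes "\<forall>\<kappa>\<in>set ks. upward \<kappa>"
  shows "tot_pos ks \<longleftrightarrow> sorted_wrt clockwise (map spinor_centre ks)"
  unfolding sorted_wrt_map using assms
  by (auto simp: bracket_pos_iff_clockwise intro: sorted_wrt_mono_rel[rotated])

section \<open>The twisted cyclic symmetry\<close>

lemma tot_pos_uminus: "tot_pos (map uminus ks) \<longleftrightarrow> tot_pos ks"
  by (simp add: sorted_wrt_map)

lemma tot_pos_rotate: "tot_pos (xs @ ys) \<Longrightarrow> tot_pos (ys @ map uminus xs)"
proof -
  \<comment> \<open>The sign compensates the exchange of the two arguments.\<close>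
  have "bracket y (- x) = bracket x y" for x y
    by (simp add: bracket_def)
  then show "tot_pos (xs @ ys) \<Longrightarrow> tot_pos (ys @ map uminus xs)"
    by (auto simp: sorted_wrt_append tot_pos_uminus simp del: bracket_uminus)
qed

text \<open>In a positive triple the second coordinates satisfy the Pluecker relation
  \<open>{a, y} \<eta>\<^sub>x = {x, y} \<eta>\<^sub>a + {a, x} \<eta>\<^sub>y\<close> with positive coefficients, so \<open>\<eta>\<^sub>x \<le> 0\<close> with
  \<open>\<eta>\<^sub>a, \<eta>\<^sub>y \<ge> 0\<close> would make \<open>a\<close> and \<open>y\<close> parallel.\<close>

lemma upward_between:
  assumes "bracket a x > 0" "bracket a y > 0" "bracket x y > 0" "upward a" "upward y"
  shows "\<not> upward (- x)"
proof
  assume x: "upward (- x)"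
  have pl: "bracket a y * x $ 2 = bracket x y * a $ 2 + bracket a x * y $ 2"
    by (simp add: bracket_def algebra_simps)
  have ge: "a $ 2 \<ge> 0" "y $ 2 \<ge> 0" "x $ 2 \<le> 0"
    using assms(4,5) x by (auto simp: upward_def)
  have "bracket a y * x $ 2 \<le> 0"
    using assms(2) ge by (simp add: mult_le_0_iff)
  moreover have "bracket x y * a $ 2 \<ge> 0" "bracket a x * y $ 2 \<ge> 0"
    using assms(1,3) ge by simp_all
  ultimately have "bracket x y * a $ 2 = 0" "bracket a x * y $ 2 = 0"
    using pl by linarith+
  then have "a $ 2 = 0" "y $ 2 = 0"
    using assms(1,3) by simp_all
  then show False
    using assms(2) by (simp add: bracket_def)
qed

text \<open>A totally positive tuple runs counterclockwise through an angle less than \<open>\<pi>\<close>, so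
  it crosses the boundary line of the half plane of upward spinors at most once.\<close>

lemma tot_pos_split:
  assumes "tot_pos ks" "0 \<notin> set ks"
  obtains xs ys where "ks = xs @ ys"
    "(\<forall>\<kappa>\<in>set (ys @ map uminus xs). upward \<kappa>) \<or> (\<forall>\<kappa>\<in>set (ys @ map uminus xs). upward (- \<kappa>))"
proof -
  have "\<exists>xs ys. ks = xs @ ys \<and>
    ((\<forall>x\<in>set xs. upward (- x)) \<and> (\<forall>y\<in>set ys. upward y) \<or>
     (\<forall>x\<in>set xs. upward x) \<and> (\<forall>y\<in>set ys. upward (- y)))"
    using assms
  proof (induction ks)
    case (Cons a ks)
    have pos: "\<And>\<kappa>. \<kappa> \<in> set ks \<Longrightarrow> bracket a \<kappa> > 0" and ks: "tot_pos ks" "0 \<notin> set ks"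
      and a: "upward a \<or> upward (- a)"
      using Cons.prems upward_or_uminus by auto
    obtain xs ys where xy: "ks = xs @ ys"
      and or: "(\<forall>x\<in>set xs. upward (- x)) \<and> (\<forall>y\<in>set ys. upward y) \<or>
       (\<forall>x\<in>set xs. upward x) \<and> (\<forall>y\<in>set ys. upward (- y))"
      using Cons.IH[OF ks] by blast
    have brackets: "bracket a x > 0 \<and> bracket a y > 0 \<and> bracket x y > 0"
      if "x \<in> set xs" "y \<in> set ys" for x y
      using that pos ks(1) by (auto simp: xy sorted_wrt_append)
    have no_up: "\<not> (upward a \<and> upward (- x) \<and> upward y)"
      if "x \<in> set xs" "y \<in> set ys" for x y
      using upward_between[of a x y] brackets[OF that] by blast
    have no_down: "\<not> (upward (- a) \<and> upward x \<and> upward (- y))"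
      if "x \<in> set xs" "y \<in> set ys" for x y
      using upward_between[of "- a" "- x" "- y"] brackets[OF that] by auto
    show ?case
    proof (cases "xs = [] \<or> ys = []")
      case True
      then have "(\<forall>x\<in>set ks. upward x) \<or> (\<forall>x\<in>set ks. upward (- x))"
        using or xy by auto
      moreover have "a # ks = [a] @ ks" "a # ks = [] @ a # ks" by simp_all
      ultimately show ?thesis
        using a by (metis empty_iff list.set(1) set_ConsD)
    next
      case False
      then obtain x y where "x \<in> set xs" "y \<in> set ys"
        by (meson ex_in_conv set_empty)
      with or no_up no_down a
      have "(\<forall>x\<in>set (a # xs). upward (- x)) \<and> (\<forall>y\<in>set ys. upward y) \<or>
          (\<forall>x\<in>set (a # xs). upward x) \<and> (\<forall>y\<in>set ys. upward (- y))"
        by auto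
      moreover have "a # ks = (a # xs) @ ys" by (simp add: xy)
      ultimately show ?thesis by blast
    qed
  qed simp
  then show thesis
    using that by fastforce
qed

section \<open>Totally positive tuples give decorated ideal polygons, and all of them\<close>

lemma map_fst_polygon_of_spinors: "map fst (polygon_of_spinors ks) = map spinor_centre ks"
  by (simp add: polygon_of_spinors_def)

lemma spinor_horocycle_at_centre:
  "\<kappa> \<noteq> 0 \<Longrightarrow> spinor_horocycle \<kappa> \<in> horocycles_at (spinor_centre \<kappa>)"
  by (cases "\<kappa> $ 2 = 0")
    (force simp: spinor_horocycle_def spinor_centre_def vec2_eq_iff)+

lemma upward_lift_exists:
  assumes "H \<in> horocycles_at z"
  shows "\<exists>\<kappa>. upward \<kappa> \<and> spinor_centre \<kappa> = z \<and> spinor_horocycle \<kappa> = H"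
proof (cases z)
  case (Fin x)
  with assms obtain D where "D > 0" "H = circle_horocycle x D" by auto
  with Fin show ?thesis
    by (intro exI[of _ "vector [x / sqrt D, 1 / sqrt D]"])
      (simp add: upward_def spinor_centre_def spinor_horocycle_def power_divide)
next
  case Infty
  with assms obtain h where "h > 0" "H = line_horocycle h" by auto
  with Infty show ?thesis
    by (intro exI[of _ "vector [sqrt h, 0]"])
      (simp add: upward_def spinor_centre_def spinor_horocycle_def)
qed

lemma polygon_of_spinors_in_decorated_ideal_polygons:
  assumes "ks \<in> totally_positive d" "d \<ge> 2"
  shows "polygon_of_spinors ks \<in> decorated_ideal_polygons d"
proof -
  have len: "length ks = d" and pos: "tot_pos ks"
    using assms(1) by (auto simp: totally_positive_iff)
  have nz: "\<kappa> \<noteq> 0" if "\<kappa> \<in> set ks" for \<kappa>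
    using tot_pos_nonzero[OF pos] assms(2) len that by blast
  then have "0 \<notin> set ks" by blast
  from tot_pos_split[OF pos this] obtain xs ys where xy: "ks = xs @ ys"
    and up: "(\<forall>\<kappa>\<in>set (ys @ map uminus xs). upward \<kappa>) \<or>
      (\<forall>\<kappa>\<in>set (ys @ map uminus xs). upward (- \<kappa>))" .
  let ?L = "ys @ map uminus xs"
  have L: "tot_pos ?L"
    using pos by (simp only: xy tot_pos_rotate)
  \<comment> \<open>A tuple of downward spinors is replaced by its negative, which has the same centres.\<close>
  have "sorted_wrt clockwise (map spinor_centre ?L)"
    using up
  proof
    assume "\<forall>\<kappa>\<in>set ?L. upward (- \<kappa>)"
    then have "\<forall>\<kappa>\<in>set (map uminus ?L). upward \<kappa>"
      by (simp only: set_map ball_simps)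
    moreover have "tot_pos (map uminus ?L)"
      using L by (simp only: tot_pos_uminus)
    ultimately have "sorted_wrt clockwise (map spinor_centre (map uminus ?L))"
      using tot_pos_iff_sorted_wrt_clockwise by blast
    moreover have "map spinor_centre (map uminus ?L) = map spinor_centre ?L"
      by simp
    ultimately show ?thesis by (simp only:)
  qed (use L tot_pos_iff_sorted_wrt_clockwise in blast)
  moreover have "map spinor_centre ?L = rotate (length xs) (map spinor_centre ks)"
    using rotate_append[of "map spinor_centre xs" "map spinor_centre ys"]
    by (simp add: xy comp_def)
  \<comment> \<open>Reduction modulo \<open>d\<close> matters if \<open>ys\<close> is empty.\<close>
  ultimately have "sorted_wrt clockwise (rotate (length xs mod d) (map spinor_centre ks))"
    by (metis len length_map rotate_conv_mod)
  moreover have "length xs mod d < d"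
    using assms(2) by simp
  ultimately have "map fst (polygon_of_spinors ks) \<in> ideal_polygons d"
    using len by (auto simp: ideal_polygons_iff map_fst_polygon_of_spinors)
  then show ?thesis
    using nz by (auto simp: decorated_ideal_polygons_def polygon_of_spinors_def
        spinor_horocycle_at_centre)
qed

lemma decorated_ideal_polygon_has_lift:
  assumes "P \<in> decorated_ideal_polygons d"
  shows "\<exists>ks \<in> totally_positive d. polygon_of_spinors ks = P"
proof -
  obtain k where len: "length P = d" and k: "k < d"
    and sorted: "sorted_wrt clockwise (rotate k (map fst P))"
    using assms by (auto simp: decorated_ideal_polygons_def ideal_polygons_iff)
  have "\<forall>p\<in>set P. \<exists>\<kappa>. upward \<kappa> \<and> (spinor_centre \<kappa>, spinor_horocycle \<kappa>) = p"
    using assms upward_lift_exists by (fastforce simp: decorated_ideal_polygons_def)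
  then obtain g where g: "\<And>p. p \<in> set P \<Longrightarrow> upward (g p)"
      "\<And>p. p \<in> set P \<Longrightarrow> (spinor_centre (g p), spinor_horocycle (g p)) = p"
    by metis
  let ?L = "map g (rotate k P)"
  have poly: "polygon_of_spinors ?L = rotate k P"
    unfolding polygon_of_spinors_def map_map by (rule map_idI) (simp add: g)
  have "map spinor_centre ?L = rotate k (map fst P)"
    using poly map_fst_polygon_of_spinors[of ?L] by (simp only: rotate_map)
  then have L: "tot_pos ?L"
    using sorted tot_pos_iff_sorted_wrt_clockwise[of ?L] g(1) by auto
  define xs ys where "xs = take (d - k) ?L" and "ys = drop (d - k) ?L"
  have xy: "?L = xs @ ys" and lx: "length xs = d - k"
    using len by (simp_all add: xs_def ys_def)
  have "polygon_of_spinors (ys @ map uminus xs) =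
      rotate (length xs) (polygon_of_spinors ?L)"
    using rotate_append[of "polygon_of_spinors xs" "polygon_of_spinors ys"]
    by (simp add: xy) (simp add: polygon_of_spinors_def)
  also have "\<dots> = rotate (d - k + k) P"
    by (simp only: lx poly rotate_rotate)
  also have "\<dots> = P"
    using k len by simp
  finally have "polygon_of_spinors (ys @ map uminus xs) = P" .
  moreover have "length (ys @ map uminus xs) = d"
    using arg_cong[OF xy, of length] len by simp
  moreover have "tot_pos (ys @ map uminus xs)"
    using L by (simp only: xy tot_pos_rotate)
  ultimately show ?thesis
    by (metis totally_positive_iff)
qed

section \<open>Fibres and orbits\<close>

text \<open>The signs of any two entries are equal because both \<open>{\<kappa>\<^sub>i, \<kappa>\<^sub>j}\<close> and
  \<open>{\<epsilon>\<^sub>i \<kappa>\<^sub>i, \<epsilon>\<^sub>j \<kappa>\<^sub>j} = \<epsilon>\<^sub>i \<epsilon>\<^sub>j {\<kappa>\<^sub>i, \<kappa>\<^sub>j}\<close> are positive; it suffices to compare with the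
  first entry.\<close>

lemma tot_pos_eq_up_to_sign:
  assumes "tot_pos ks" "tot_pos ls" "0 \<notin> set ks"
    and eq: "polygon_of_spinors ks = polygon_of_spinors ls"
  shows "ls = ks \<or> ls = map uminus ks"
proof -
  have len: "length ls = length ks"
    using arg_cong[OF eq, of length] by (simp add: polygon_of_spinors_def)
  have sgn: "ls ! i = ks ! i \<or> ls ! i = - (ks ! i)" if "i < length ks" for i
  proof (rule spinor_eq_up_to_sign)
    have "polygon_of_spinors ks ! i = polygon_of_spinors ls ! i"
      by (simp add: eq)
    then show "spinor_centre (ks ! i) = spinor_centre (ls ! i)"
      and "spinor_horocycle (ks ! i) = spinor_horocycle (ls ! i)"
      using that len by (auto simp: polygon_of_spinors_def)
    show "ks ! i \<noteq> 0"
      using that assms(3) by (metis nth_mem)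
  qed
  have pos: "bracket (ks ! 0) (ks ! i) > 0" "bracket (ls ! 0) (ls ! i) > 0"
    if "i < length ks" "i \<noteq> 0" for i
    using assms(1,2) that len by (simp_all add: sorted_wrt_iff_nth_less)
  show ?thesis
  proof (cases "ks = []")
    case False
    then have "ls ! 0 = ks ! 0 \<or> ls ! 0 = - (ks ! 0)"
      by (intro sgn) simp
    then show ?thesis
    proof
      assume 0: "ls ! 0 = ks ! 0"
      have "ls ! i = ks ! i" if "i < length ks" for i
        using sgn[OF that] pos[OF that] 0 by (cases "i = 0") auto
      with len show ?thesis by (simp add: nth_equalityI)
    next
      assume 0: "ls ! 0 = - (ks ! 0)"
      have "ls ! i = - (ks ! i)" if "i < length ks" for i
        using sgn[OF that] pos[OF that] 0 by (cases "i = 0") auto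
      with len show ?thesis by (simp add: list_eq_iff_nth_eq)
    qed
  qed (use len in simp)
qed

lemma spinor_act_totally_positive:
  assumes "det A = 1" "ks \<in> totally_positive d"
  shows "spinor_act A ks \<in> totally_positive d"
  using assms by (simp add: totally_positive_iff spinor_act_def sorted_wrt_map bracket_matrix)

lemma orbit_SL2R: "orbit SL2R spinor_act ks = {spinor_act A ks |A. det A = 1}"
  by (auto simp: orbit_def SL2R_def)

lemma orbit_PSL2R: "orbit PSL2R polygon_act P = {moebius_polygon A P |A. det A = 1}"
proof -
  have "orbit PSL2R polygon_act P = {polygon_act {A, - A} P |A. det A = 1}"
    by (auto simp: orbit_def carrier_PSL2R SL2R_def)
  also have "\<dots> = {moebius_polygon A P |A. det A = 1}"
  proof -
    have "polygon_act {A, - A} P = moebius_polygon A P" if "det A = 1" for A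
      by (rule polygon_act_class) (use that in \<open>auto simp: carrier_PSL2R SL2R_def\<close>)
    then show ?thesis by metis
  qed
  finally show ?thesis .
qed

lemma totally_positive_nonzero:
  assumes "ks \<in> totally_positive d" "d \<ge> 2"
  shows "0 \<notin> set ks"
  using assms tot_pos_nonzero[of ks] by (auto simp: totally_positive_iff)

lemma polygon_image_orbit:
  assumes "ks \<in> totally_positive d" "d \<ge> 2"
  shows "polygon_of_spinors ` orbit SL2R spinor_act ks =
    orbit PSL2R polygon_act (polygon_of_spinors ks)"
proof -
  have "moebius_polygon A (polygon_of_spinors ks) = polygon_of_spinors (spinor_act A ks)"
    if "det A = 1" for A
    using polygon_of_spinors_act[OF that totally_positive_nonzero[OF assms]] .
  then show ?thesis
    unfolding orbit_SL2R orbit_PSL2R by (force simp: image_iff)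
qed

text \<open>Orbits are saturated with respect to the fibres of the polygon map, because they contain
  with each tuple also its negative.\<close>

lemma orbit_eq_preimage:
  assumes "ks \<in> totally_positive d" "d \<ge> 2"
  shows "orbit SL2R spinor_act ks =
    {ls \<in> totally_positive d. polygon_of_spinors ls \<in> polygon_of_spinors ` orbit SL2R spinor_act ks}"
proof (intro equalityI subsetI)
  fix ls assume "ls \<in> orbit SL2R spinor_act ks"
  then show "ls \<in> {ls \<in> totally_positive d.
      polygon_of_spinors ls \<in> polygon_of_spinors ` orbit SL2R spinor_act ks}"
    using assms(1) by (auto simp: orbit_SL2R spinor_act_totally_positive)
next
  fix ls assume "ls \<in> {ls \<in> totally_positive d.
      polygon_of_spinors ls \<in> polygon_of_spinors ` orbit SL2R spinor_act ks}"
  then obtain A where ls: "ls \<in> totally_positive d" and A: "det A = 1"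
    and eq: "polygon_of_spinors (spinor_act A ks) = polygon_of_spinors ls"
    by (auto simp: orbit_SL2R)
  have Aks: "spinor_act A ks \<in> totally_positive d"
    by (rule spinor_act_totally_positive[OF A assms(1)])
  have "ls = spinor_act A ks \<or> ls = map uminus (spinor_act A ks)"
    using tot_pos_eq_up_to_sign[OF _ _ totally_positive_nonzero[OF Aks assms(2)] eq] Aks ls
    by (simp add: totally_positive_iff)
  moreover have "map uminus (spinor_act A ks) = spinor_act (- A) ks"
    by (simp add: spinor_act_def vec2_eq_iff matrix_vector_mult_2)
  moreover have "det (- A) = 1"
    using A by (simp add: det_uminus_2)
  ultimately show "ls \<in> orbit SL2R spinor_act ks"
    using A by (auto simp: orbit_SL2R)
qed

theorem proposition6p9:
  fixes d :: nat
  assumes "d \<ge> 3"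
  shows "polygon_of_spinors ` totally_positive d \<subseteq> decorated_ideal_polygons d \<and>
    (\<exists>\<Phi>. (\<forall>ks \<in> totally_positive d.
             \<Phi> (orbit SL2R spinor_act ks) = orbit PSL2R polygon_act (polygon_of_spinors ks)) \<and>
         bij_betw \<Phi> (orbits SL2R (totally_positive d) spinor_act) (T_tilde d))"
proof -
  have d: "d \<ge> 2" using assms by simp
  let ?\<Phi> = "\<lambda>X. polygon_of_spinors ` X"
  have img: "polygon_of_spinors ` totally_positive d = decorated_ideal_polygons d"
    using polygon_of_spinors_in_decorated_ideal_polygons[OF _ d] decorated_ideal_polygon_has_lift
    by blast
  have orb: "\<forall>ks \<in> totally_positive d.
      ?\<Phi> (orbit SL2R spinor_act ks) = orbit PSL2R polygon_act (polygon_of_spinors ks)"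
    using polygon_image_orbit[OF _ d] by blast
  have "inj_on ?\<Phi> (orbits SL2R (totally_positive d) spinor_act)"
  proof (rule inj_on_inverseI)
    fix X assume "X \<in> orbits SL2R (totally_positive d) spinor_act"
    then obtain ks where "ks \<in> totally_positive d" "X = orbit SL2R spinor_act ks"
      by (auto simp: orbits_def)
    then show "{ls \<in> totally_positive d. polygon_of_spinors ls \<in> ?\<Phi> X} = X"
      using orbit_eq_preimage[OF _ d] by simp
  qed
  moreover have "?\<Phi> ` orbits SL2R (totally_positive d) spinor_act = T_tilde d"
  proof -
    have "T_tilde d = (\<lambda>ks. orbit PSL2R polygon_act (polygon_of_spinors ks)) ` totally_positive d"
      unfolding T_tilde_def orbits_def img[symmetric] by blast
    also have "\<dots> = (\<lambda>ks. ?\<Phi> (orbit SL2R spinor_act ks)) ` totally_positive d"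
      using orb by (intro image_cong) auto
    also have "\<dots> = ?\<Phi> ` orbits SL2R (totally_positive d) spinor_act"
      unfolding orbits_def by blast
    finally show ?thesis by simp
  qed
  ultimately have "bij_betw ?\<Phi> (orbits SL2R (totally_positive d) spinor_act) (T_tilde d)"
    by (simp add: bij_betw_def)
  with img orb show ?thesis by blast
qed

end
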